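(* Let $c = 121$. For every finite simple graph $G$, all $X, Y \subseteq V(G)$, and every integer $d \ge 1$, either there exist two disjoint $X-Y$ paths $P_1, P_2$ in $G$ such that $\mathrm{dist}_G(P_1, P_2) \ge d$, or there exists a vertex $z \in V(G)$ such that $B_G(z, cd)$ intersects (i.e. contains a vertex of) every $X-Y$ path in $G$.
   Context: All graphs are finite and simple. For $X, Y \subseteq V(G)$, an $X-Y$ path is a path with one end in $X$, one end in $Y$, and no internal vertex in $X \cup Y$; a single vertex of $X \cap Y$ counts as an $X-Y$ path; if $X$ or $Y$ is empty, no $X-Y$ path exists. For $u,v \in V(G)$, $\mathrm{dist}_G(u,v)$ is the length (number of edges) of a shortest $u-v$ path in $G$. For an integer $r \ge 0$ and $v \in V(G)$, the ball $B_G(v,r) := \{u \in V(G) : \mathrm{dist}_G(u,v) \le r\}$. For subgraphs $H_1, H_2$ of $G$, $\mathrm{dist}_G(H_1,H_2)$ is the minimum length of a $V(H_1)-V(H_2)$ path in $G$. *)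

theory Defs
  imports "Graph_Theory.Graph_Theory" "HOL-Library.Extended_Nat"
begin

text \<open>
  Finite simple graphs are the symmetric digraphs of the locale \<open>graph\<close>: finite, loop-free, without
  parallel arcs. A path is the list of its vertices (\<open>vpath\<close>), hence comes with a direction; an
  \<open>X\<close>-\<open>Y\<close> path is listed starting from its end in \<open>X\<close>. For a single vertex both ends coincide and
  there are no internal vertices.
\<close>

definition internal_verts :: "'a vwalk \<Rightarrow> 'a set" where
  "internal_verts p = set (butlast (tl p))"

definition XY_path :: "('a,'b) pre_digraph \<Rightarrow> 'a set \<Rightarrow> 'a set \<Rightarrow> 'a vwalk \<Rightarrow> bool" where
  "XY_path G X Y p \<longleftrightarrow>
     vpath p G \<and> hd p \<in> X \<and> last p \<in> Y \<and> internal_verts p \<inter> (X \<union> Y) = {}"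

text \<open>
  Distances are extended naturals: the infimum over the empty set is \<open>\<infinity>\<close>, so vertices or subgraphs
  not joined by a path are at infinite distance.
\<close>

definition vdist :: "('a,'b) pre_digraph \<Rightarrow> 'a \<Rightarrow> 'a \<Rightarrow> enat" where
  "vdist G u v = (INF p \<in> {p. vpath p G \<and> hd p = u \<and> last p = v}. enat (vwalk_length p))"

definition gball :: "('a,'b) pre_digraph \<Rightarrow> 'a \<Rightarrow> nat \<Rightarrow> 'a set" where
  "gball G v r = {u \<in> verts G. vdist G u v \<le> enat r}"

text \<open>The distance of two subgraphs depends only on their vertex sets, which are the arguments here.\<close>

definition subgraph_dist :: "('a,'b) pre_digraph \<Rightarrow> 'a set \<Rightarrow> 'a set \<Rightarrow> enat" where
  "subgraph_dist G A B = (INF p \<in> {p. XY_path G A B p}. enat (vwalk_length p))"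

end

theory Submission
  imports Defs
begin

text \<open>
  Let \<open>P = p\<^sub>0 \<dots> p\<^sub>L\<close> be a shortest \<open>X\<close>-\<open>Y\<close> path, let \<open>W\<close> be the set of vertices at distance at least
  \<open>3d\<close> from \<open>P\<close>, and suppose that no ball of radius \<open>121d\<close> around a vertex of \<open>P\<close> meets all
  \<open>X\<close>-\<open>Y\<close> paths. Consider walks through \<open>W\<close> from \<open>X\<close> to \<open>Y\<close> composed of free steps along edges inside
  \<open>W\<close>, short links through the neighbourhood of \<open>P\<close>, paid for by their length, and hops, which go down
  to some \<open>p\<^sub>b\<close>, backwards along \<open>P\<close> to some \<open>p\<^sub>a\<close> and up again, at a fixed price plus a penalty if
  \<open>b - a\<close> is small. Take a cheapest walk. An \<open>X\<close>-\<open>Y\<close> path avoiding the ball around \<open>p\<^sub>b\<close> jumps far over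
  \<open>p\<^sub>b\<close> inside \<open>W\<close>, so a long link or a hop with a large penalty could be replaced by two full
  hops; hence links are short and stay away from \<open>P\<close>, and all hops overlap substantially. The hops cut
  the walk into pieces \<open>S\<^sub>0, \<dots>, S\<^sub>k\<close>, each jumping over a segment of \<open>P\<close>. Two pieces close to each other
  would give a link that is cheaper than the hops between them, so pieces are far apart, and the
  optimality of the hops orders the segments along \<open>P\<close> with large gaps. As for augmenting paths,
  the pieces with even index joined by the segments under the odd ones, and vice versa, form two
  connected sets from \<open>X\<close> to \<open>Y\<close> at distance at least \<open>d\<close>.
\<close>

section \<open>Connectivity inside a set by steps of length at most one\<close>

definition linked :: "('a \<Rightarrow> 'a \<Rightarrow> nat) \<Rightarrow> 'a set \<Rightarrow> 'a \<Rightarrow> 'a \<Rightarrow> bool" where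
  "linked D S = (\<lambda>u v. u \<in> S \<and> v \<in> S \<and> D u v \<le> 1)\<^sup>*\<^sup>*"

lemma linked_refl [simp]: "linked D S x x"
  by (simp add: linked_def)

lemma linked_trans [trans]: "linked D S x y \<Longrightarrow> linked D S y z \<Longrightarrow> linked D S x z"
  unfolding linked_def by (rule rtranclp_trans)

lemma linked_step: "u \<in> S \<Longrightarrow> v \<in> S \<Longrightarrow> D u v \<le> 1 \<Longrightarrow> linked D S u v"
  unfolding linked_def by (rule r_into_rtranclp) simp

lemma linked_mono: "linked D S x y \<Longrightarrow> S \<subseteq> T \<Longrightarrow> linked D T x y"
  unfolding linked_def by (erule rtranclp_mono[THEN predicate2D, rotated]) auto

lemma linked_sym:
  assumes "\<And>x y. D x y = D y x" and "linked D S x y"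
  shows "linked D S y x"
proof -
  have "symp (\<lambda>u v. u \<in> S \<and> v \<in> S \<and> D u v \<le> 1)"
    using assms(1) by (auto intro!: sympI)
  then show ?thesis
    using assms(2) unfolding linked_def by (meson symp_rtranclp sympD)
qed

lemma linked_seq:
  assumes "\<And>t. l \<le> t \<Longrightarrow> t \<le> r \<Longrightarrow> q t \<in> S"
    and "\<And>t. l \<le> t \<Longrightarrow> t < r \<Longrightarrow> D (q t) (q (Suc t)) \<le> 1"
    and "l \<le> r"
  shows "linked D S (q l) (q r)"
  using assms(3,1,2)
proof (induction r rule: dec_induct)
  case (step n)
  have "linked D S (q l) (q n)" using step by simp
  also have "linked D S (q n) (q (Suc n))"
    using step by (intro linked_step) auto
  finally show ?case .
qed simp

section \<open>The setting around a shortest path, in metric terms\<close>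

text \<open>\<open>D\<close> stands for a graph distance truncated at a large value, which is why
  geodesics are only available below \<open>bound\<close>. \<open>D_p\<close>, \<open>D_X\<close>
  and \<open>D_Y\<close> encode that \<open>p\<close> is a shortest connection from \<open>X\<close>
  to \<open>Y\<close>, and \<open>escape\<close> is the failure of the ball alternative at each
  vertex of \<open>p\<close>.\<close>

locale coarse_strip =
  fixes D :: "'a \<Rightarrow> 'a \<Rightarrow> nat" and X Y :: "'a set" and p :: "nat \<Rightarrow> 'a" and L d bound :: nat
  assumes d_pos: "d \<ge> 1"
    and D_refl [simp]: "D x x = 0"
    and D_sym: "D x y = D y x"
    and D_triangle: "D x z \<le> D x y + D y z"
    and D_geodesic: "D x y = Suc n \<Longrightarrow> Suc n < bound \<Longrightarrow> \<exists>z. D x z \<le> 1 \<and> D z y = n"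
    and bound: "10 * d < bound"
    and p_X: "p 0 \<in> X" and p_Y: "p L \<in> Y"
    and D_p: "i \<le> j \<Longrightarrow> j \<le> L \<Longrightarrow> D (p i) (p j) = j - i"
    and D_X: "x \<in> X \<Longrightarrow> i \<le> L \<Longrightarrow> i \<le> D x (p i)"
    and D_Y: "y \<in> Y \<Longrightarrow> i \<le> L \<Longrightarrow> L - i \<le> D y (p i)"
    and escape: "i \<le> L \<Longrightarrow> \<exists>q n. q 0 \<in> X \<and> q n \<in> Y \<and>
          (\<forall>t<n. D (q t) (q (Suc t)) \<le> 1) \<and> (\<forall>t\<le>n. 121 * d < D (q t) (p i))"
begin

definition geo :: "'a \<Rightarrow> 'a \<Rightarrow> 'a set" where
  "geo x y = {u. D x u + D u y = D x y}"

lemma geo_ends [simp]: "x \<in> geo x y" "y \<in> geo x y"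
  by (auto simp: geo_def)

lemma linked_geo:
  assumes "D x y < bound"
  shows "linked D (geo x y) x y"
  using assms
proof (induction "D x y" arbitrary: x)
  case 0
  then show ?case by (intro linked_step) auto
next
  case (Suc n)
  then obtain z where z: "D x z \<le> 1" "D z y = n"
    by (metis D_geodesic)
  have xz: "D x z = 1"
    using z Suc.hyps(2) D_triangle[of x y z] by linarith
  have sub: "geo z y \<subseteq> geo x y"
  proof
    fix u assume "u \<in> geo z y"
    then show "u \<in> geo x y"
      using xz z(2) Suc.hyps(2) D_triangle[of x u z] D_triangle[of x y u]
      by (simp add: geo_def)
  qed
  have "z \<in> geo x y"
    using xz z Suc.hyps(2) by (simp add: geo_def)
  then have "linked D (geo x y) x z"
    using z by (intro linked_step) auto
  also have "linked D (geo z y) z y"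
    using Suc z by simp
  then have "linked D (geo x y) z y"
    using sub by (rule linked_mono)
  finally show ?case .
qed

section \<open>The region away from the path, and bypasses inside it\<close>

definition W :: "'a set" where
  "W = {v. \<forall>i\<le>L. 3 * d \<le> D v (p i)}"

definition pos :: "'a \<Rightarrow> nat \<Rightarrow> bool" where
  "pos v i \<longleftrightarrow> v \<in> W \<and> i \<le> L \<and> D v (p i) = 3 * d"

lemma WD: "v \<in> W \<Longrightarrow> i \<le> L \<Longrightarrow> 3 * d \<le> D v (p i)"
  by (simp add: W_def)

lemma D_p_le: "i \<le> L \<Longrightarrow> j \<le> L \<Longrightarrow> j \<le> i + D (p i) (p j)"
  using D_p[of i j] by (cases "i \<le> j") auto

text \<open>As \<open>p\<close> is geodesic, positions cannot differ by more than the length of the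
  detour through \<open>u\<close> and \<open>v\<close>.\<close>

lemma pos_diff:
  assumes "D u (p a) \<le> m" "D v (p b) \<le> n" "a \<le> L" "b \<le> L"
  shows "b \<le> a + m + D u v + n"
  using D_p_le[of a b] assms D_triangle[of "p a" "p b" u] D_triangle[of u "p b" v] D_sym[of "p a" u]
  by linarith

text \<open>A vertex of the escaping walk within \<open>3 * d\<close> of some \<open>p a\<close> has
  \<open>a\<close> at least \<open>118 * d\<close> away from \<open>i\<close>, because the walk
  stays outside radius \<open>121 * d\<close>. The stretch that ends at the first
  \<open>right\<close> visit and starts at the last \<open>left\<close> visit before it lies in
  \<open>W\<close>; a missing visit is replaced by the end of the walk in \<open>X\<close> or
  \<open>Y\<close>.\<close>

lemma bypass:
  assumes i: "i \<le> L"
  obtains x y where "linked D W x y" "x \<in> W" "y \<in> W"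
    "x \<in> X \<or> (\<exists>a. pos x a \<and> a + 118 * d \<le> i)"
    "y \<in> Y \<or> (\<exists>b. pos y b \<and> i + 118 * d \<le> b)"
proof -
  obtain q n where q: "q 0 \<in> X" "q n \<in> Y"
    and step: "\<And>t. t < n \<Longrightarrow> D (q t) (q (Suc t)) \<le> 1"
    and far: "\<And>t. t \<le> n \<Longrightarrow> 121 * d < D (q t) (p i)"
    using escape[OF i] by metis
  define left where "left t \<longleftrightarrow> (\<exists>a\<le>L. a + 118 * d \<le> i \<and> D (q t) (p a) \<le> 3 * d)" for t
  define right where "right t \<longleftrightarrow> (\<exists>b\<le>L. i + 118 * d \<le> b \<and> D (q t) (p b) \<le> 3 * d)" for t
  have deep: "3 * d < D (q t) (p a)" if "t \<le> n" "\<not> left t" "\<not> right t" "a \<le> L" for t a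
  proof (rule ccontr)
    assume "\<not> ?thesis"
    then have near: "D (q t) (p a) \<le> 3 * d" by simp
    have "D (q t) (p i) \<le> D (q t) (p a) + D (p a) (p i)" by (rule D_triangle)
    with near far[OF that(1)] have "118 * d < D (p a) (p i)" by linarith
    then have "a + 118 * d \<le> i \<or> i + 118 * d \<le> a"
      using D_p[of a i] D_p[of i a] D_sym[of "p a" "p i"] that(4) i by (cases "a \<le> i") auto
    with that near show False unfolding left_def right_def by blast
  qed
  \<comment> \<open>Attachment positions on different sides of \<open>i\<close> differ by at least
    \<open>236 * d\<close>, but a single step allows only \<open>6 * d + 1\<close>.\<close>
  have left_right: False if st: "left s" "right t" "D (q s) (q t) \<le> 1" for s t
  proof -
    obtain a b where "a \<le> L" "a + 118 * d \<le> i" "D (q s) (p a) \<le> 3 * d"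
      and "b \<le> L" "i + 118 * d \<le> b" "D (q t) (p b) \<le> 3 * d"
      using st unfolding left_def right_def by blast
    then show False
      using pos_diff[of "q s" a "3*d" "q t" b "3*d"] st(3) d_pos by linarith
  qed
  have right0: "\<not> right 0"
    using D_X[OF q(1)] d_pos unfolding right_def by fastforce
  have leftn: "\<not> left n"
  proof
    assume "left n"
    then obtain a where "a \<le> L" "a + 118 * d \<le> i" "D (q n) (p a) \<le> 3 * d"
      unfolding left_def by blast
    then show False using D_Y[OF q(2), of a] d_pos i by linarith
  qed
  define r where "r = (LEAST t. t = n \<or> right t)"
  have r: "r = n \<or> right r" unfolding r_def by (rule LeastI[of _ n]) simp
  have rn: "r \<le> n" unfolding r_def by (rule Least_le) simp
  have below_r: "\<not> right t" if "t < r" for t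
    using not_less_Least[of t] that unfolding r_def by blast
  define l where "l = (GREATEST t. t \<le> r \<and> (t = 0 \<or> left t))"
  have l: "l \<le> r" "l = 0 \<or> left l"
    using GreatestI_nat[of "\<lambda>t. t \<le> r \<and> (t = 0 \<or> left t)" 0 r] unfolding l_def by auto
  have above_l: "\<not> left t" if "l < t" "t \<le> r" for t
    using Greatest_le_nat[of "\<lambda>t. t \<le> r \<and> (t = 0 \<or> left t)" t r] that unfolding l_def by auto
  have nlr: "\<not> left r" if "right r" using left_right[of r r] that by auto
  have nlr': "\<not> left r" using nlr leftn r by auto
  have nrl: "\<not> right l" using l right0 below_r[of l] nlr' nlr r by (cases "l = r") auto
  \<comment> \<open>The inequality in \<open>deep\<close> is strict, so one step away the distance
    is still at least \<open>3 * d\<close>. This puts both end vertices of the stretch into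
    \<open>W\<close>, although they may be within \<open>3 * d\<close> of the path.\<close>
  have W_of_deep: "q s \<in> W"
    if "\<And>a. a \<le> L \<Longrightarrow> 3 * d < D (q t) (p a)" "D (q s) (q t) \<le> 1" for s t
    unfolding W_def
  proof (intro CollectI allI impI)
    fix a assume "a \<le> L"
    then show "3 * d \<le> D (q s) (p a)"
      using that(1)[of a] that(2) D_triangle[of "q t" "p a" "q s"] D_sym[of "q t" "q s"] by linarith
  qed
  have inW: "q t \<in> W" if t: "l \<le> t" "t \<le> r" for t
  proof (cases "left t \<or> right t")
    case False
    then show ?thesis using deep[of t] that rn by (intro W_of_deep[of t t]) auto
  next
    case True
    then consider "left t" "t = l" "l < r" | "right t" "t = r" "l < r"
      using above_l[of t] below_r[of t] nlr' nrl t by (cases "t = r"; cases "t = l") auto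
    then show ?thesis
    proof cases
      case 1
      have "\<not> right (Suc l)" using left_right[of l "Suc l"] 1 step[of l] rn by auto
      then show ?thesis
        using 1 deep[of "Suc l"] above_l[of "Suc l"] step[of l] rn
        by (intro W_of_deep[of "Suc l"]) auto
    next
      case 2
      then obtain m where m: "r = Suc m" by (cases r) auto
      have "\<not> left m" using left_right[of m r] 2 step[of m] rn m by auto
      then show ?thesis
        using 2 m deep[of m] below_r[of m] step[of m] rn D_sym[of "q r" "q m"]
        by (intro W_of_deep[of m]) auto
    qed
  qed
  show thesis
  proof (rule that)
    show "linked D W (q l) (q r)"
      using inW step l rn by (intro linked_seq) auto
    show lW: "q l \<in> W" and rW: "q r \<in> W" using inW l by auto
    show "q l \<in> X \<or> (\<exists>a. pos (q l) a \<and> a + 118 * d \<le> i)"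
    proof (cases "left l")
      case True
      then obtain a where "a \<le> L" "a + 118 * d \<le> i" "D (q l) (p a) \<le> 3 * d"
        unfolding left_def by blast
      then have "pos (q l) a" using WD[OF lW, of a] lW by (simp add: pos_def)
      then show ?thesis using \<open>a + 118 * d \<le> i\<close> by blast
    qed (use l q in auto)
    show "q r \<in> Y \<or> (\<exists>b. pos (q r) b \<and> i + 118 * d \<le> b)"
    proof (cases "right r")
      case True
      then obtain b where "b \<le> L" "i + 118 * d \<le> b" "D (q r) (p b) \<le> 3 * d"
        unfolding right_def by blast
      then have "pos (q r) b" using WD[OF rW, of b] rW by (simp add: pos_def)
      then show ?thesis using \<open>i + 118 * d \<le> b\<close> by blast
    qed (use r q in auto)
  qed
qed

section \<open>Priced walks and their cheapest cost\<close>

text \<open>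
  The subtraction in the price of a hop is truncated: overlaps \<open>b - a\<close> below \<open>21d\<close> are penalised.
\<close>

inductive move :: "'a \<Rightarrow> 'a \<Rightarrow> nat \<Rightarrow> bool" where
  edge: "x \<in> W \<Longrightarrow> y \<in> W \<Longrightarrow> D x y \<le> 1 \<Longrightarrow> move x y 0"
| link: "x \<in> W \<Longrightarrow> y \<in> W \<Longrightarrow> D x y \<le> 10 * d \<Longrightarrow> move x y (7 * D x y)"
| hop: "pos x b \<Longrightarrow> pos y a \<Longrightarrow> move x y (14 * d + (21 * d + a - b))"

inductive reach :: "nat \<Rightarrow> 'a \<Rightarrow> bool" where
  start: "x \<in> X \<Longrightarrow> x \<in> W \<Longrightarrow> reach 0 x"
| step: "reach n x \<Longrightarrow> move x y c \<Longrightarrow> reach (n + c) y"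

definition reachable :: "'a \<Rightarrow> bool" where
  "reachable x \<longleftrightarrow> (\<exists>n. reach n x)"

text \<open>A junk value unless \<open>reachable x\<close>, hence the reachability hypotheses
  below.\<close>

definition \<phi> :: "'a \<Rightarrow> nat" where
  "\<phi> x = (LEAST n. reach n x)"

lemma reach_\<phi>: "reachable x \<Longrightarrow> reach (\<phi> x) x"
  unfolding reachable_def \<phi>_def by (auto intro: LeastI)

lemma \<phi>_le: "reach n x \<Longrightarrow> \<phi> x \<le> n"
  unfolding \<phi>_def by (rule Least_le)

lemma reachable_W: "reachable x \<Longrightarrow> x \<in> W"
proof -
  assume "reachable x"
  then obtain n where "reach n x" unfolding reachable_def ..
  then show "x \<in> W"
  proof cases
    case (step m z c)
    from step(3) show ?thesis by cases (auto simp: pos_def)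
  qed
qed

lemma move_reachable:
  assumes "reachable x" "move x y c"
  shows "reachable y" "\<phi> y \<le> \<phi> x + c"
  using reach.step[OF reach_\<phi>[OF assms(1)] assms(2)] \<phi>_le by (auto simp: reachable_def)

lemma \<phi>_X: "x \<in> X \<Longrightarrow> x \<in> W \<Longrightarrow> reachable x" "x \<in> X \<Longrightarrow> x \<in> W \<Longrightarrow> \<phi> x = 0"
  using reach.start[of x] \<phi>_le[of 0 x] by (auto simp: reachable_def)

lemma linked_reachable_le:
  assumes "linked D W x y" "reachable x"
  shows "reachable y \<and> \<phi> y \<le> \<phi> x"
  using assms(1) unfolding linked_def
proof (induction rule: rtranclp_induct)
  case (step y z)
  then show ?case using move_reachable[of y z 0] edge[of y z] by force
qed (use assms in auto)

text \<open>Free edges can be used in both directions, so \<open>\<phi>\<close> is constant on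
  connected parts of \<open>W\<close>.\<close>

lemma linked_reachable:
  assumes "linked D W x y" "reachable x"
  shows "reachable y" "\<phi> y = \<phi> x"
  using linked_reachable_le[OF assms] linked_reachable_le[of y x] linked_sym[OF D_sym assms(1)]
  by auto

text \<open>The bypass at \<open>p 0\<close> must start in \<open>X\<close> and the one at
  \<open>p L\<close> must end in \<open>Y\<close>, since no position lies beyond the ends of the
  path. Unless one of them already does the job, a single hop joins them, with a possibly large but
  finite penalty.\<close>

lemma Y_reachable: "\<exists>y\<in>Y. reachable y"
proof -
  obtain x y where xy: "linked D W x y" "x \<in> W" "x \<in> X \<or> (\<exists>a. pos x a \<and> a + 118 * d \<le> 0)"
    "y \<in> Y \<or> (\<exists>b. pos y b)"
    using bypass[of 0] by (metis le0)
  obtain x' y' where xy': "linked D W x' y'" "x' \<in> W" "x' \<in> X \<or> (\<exists>a. pos x' a)"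
    "y' \<in> Y \<or> (\<exists>b. pos y' b \<and> L + 118 * d \<le> b)"
    using bypass[of L] by (metis order_refl)
  have "x \<in> X" using xy(3) d_pos by auto
  then have y: "reachable y" using linked_reachable xy \<phi>_X by blast
  have y': "y' \<in> Y" using xy'(4) d_pos by (auto simp: pos_def)
  show ?thesis
  proof (cases "y \<in> Y")
    case False
    with xy obtain b where "pos y b" by blast
    then have "reachable x'"
      using xy' y move_reachable(1)[OF y hop] \<phi>_X(1) by blast
    then show ?thesis using linked_reachable xy' y' by blast
  qed (use y in auto)
qed

definition opt :: nat where
  "opt = (LEAST n. \<exists>y\<in>Y. reachable y \<and> \<phi> y = n)"

lemma opt_le: "y \<in> Y \<Longrightarrow> reachable y \<Longrightarrow> opt \<le> \<phi> y"
  unfolding opt_def by (rule Least_le) auto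

lemma opt_attained: "\<exists>y\<in>Y. reachable y \<and> \<phi> y = opt"
  unfolding opt_def using Y_reachable LeastI_ex[of "\<lambda>n. \<exists>y\<in>Y. reachable y \<and> \<phi> y = n"] by blast

section \<open>Exchange arguments for cheapest walks\<close>

text \<open>
  Between \<open>x\<close> and \<open>y\<close> one can hop to the bypass of \<open>p b\<close>, follow it for free, and hop again. If the
  bypass starts in \<open>X\<close> or ends in \<open>Y\<close>, this only gets cheaper.
\<close>

lemma exchange:
  assumes x: "reachable x" and xb: "pos x b" and ya: "pos y a"
  shows "\<phi> y \<le> \<phi> x + 28 * d + (21 * d + a - (b + 118 * d)) \<or> opt \<le> \<phi> x + 14 * d"
proof -
  obtain u v where uv: "linked D W u v" "u \<in> W" "v \<in> W"
    and u: "u \<in> X \<or> (\<exists>a'. pos u a' \<and> a' + 118 * d \<le> b)"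
    and v: "v \<in> Y \<or> (\<exists>b'. pos v b' \<and> b + 118 * d \<le> b')"
    using bypass[of b] xb unfolding pos_def by metis
  \<comment> \<open>An overlap of at least \<open>118 * d\<close> makes the truncated penalty
    vanish, so this hop costs exactly \<open>14 * d\<close>.\<close>
  have u': "reachable u \<and> \<phi> u \<le> \<phi> x + 14 * d"
    using u
  proof
    assume "\<exists>a'. pos u a' \<and> a' + 118 * d \<le> b"
    then obtain a' where "pos u a'" "a' + 118 * d \<le> b" by blast
    then show ?thesis using move_reachable[OF x hop[OF xb, of u a']] by auto
  qed (use \<phi>_X uv in auto)
  have v': "reachable v" "\<phi> v \<le> \<phi> x + 14 * d"
    using linked_reachable[OF uv(1)] u' by auto
  show ?thesis
    using v
  proof
    assume "\<exists>b'. pos v b' \<and> b + 118 * d \<le> b'"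
    then obtain b' where b': "pos v b'" "b + 118 * d \<le> b'" by blast
    have "\<phi> y \<le> \<phi> v + (14 * d + (21 * d + a - b'))"
      using move_reachable[OF v'(1) hop[OF b'(1) ya]] by auto
    with b' v' show ?thesis by linarith
  qed (use opt_le v' in fastforce)
qed

text \<open>With an overlap below \<open>7 * d\<close> the penalty alone would exceed
  \<open>14 * d\<close>; the hop would then cost more than the two hops of \<open>exchange\<close>,
  and more than finishing in \<open>Y\<close> directly.\<close>

lemma hop_overlap:
  assumes "reachable x" "pos x b" "pos y a"
    and "\<phi> y = \<phi> x + (14 * d + (21 * d + a - b))" "\<phi> y \<le> opt"
  shows "a + 7 * d \<le> b"
  using exchange[OF assms(1-3)] assms(4,5) d_pos by linarith

text \<open>Consider a geodesic from \<open>a\<close> to \<open>b\<close>. If it stays in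
  \<open>W\<close> it is free, and tightness gives \<open>D a b = 0\<close>. Otherwise the vertices
  before its first exit from \<open>W\<close> and after its last return lie at distance exactly
  \<open>3 * d\<close> from the path, and \<open>exchange\<close> connects them at price
  \<open>28 * d\<close>. A link costs 7 per unit of length, whence the bound
  \<open>4 * d\<close>.\<close>

lemma link_short:
  assumes a: "reachable a" and b: "reachable b" and ab: "D a b \<le> 10 * d"
    and tight: "\<phi> b = \<phi> a + 7 * D a b" and "\<phi> b \<le> opt"
  shows "D a b \<le> 4 * d"
proof -
  have "linked D (geo a b) a b" using ab bound by (intro linked_geo) auto
  then obtain q n where q: "q 0 = a" "q n = b"
    and stp: "\<And>t. t < n \<Longrightarrow> q t \<in> geo a b \<and> q (Suc t) \<in> geo a b \<and> D (q t) (q (Suc t)) \<le> 1"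
    unfolding linked_def by (auto dest!: rtranclp_imp_relpowp simp: relpowp_fun_conv)
  have W_ends: "a \<in> W" "b \<in> W" using a b reachable_W by auto
  have bdry: "\<exists>i. pos u i" if uv: "u \<in> W" "v \<notin> W" "D u v \<le> 1" for u v
  proof -
    obtain i where i: "i \<le> L" "D v (p i) < 3 * d" using uv(2) unfolding W_def by force
    then have "D u (p i) \<le> 3 * d" using D_triangle[of u "p i" v] uv(3) by linarith
    then show ?thesis using WD[OF uv(1) i(1)] i(1) uv(1) by (auto simp: pos_def)
  qed
  show ?thesis
  proof (cases "\<forall>t\<le>n. q t \<in> W")
    case True
    then have "linked D W (q 0) (q n)" using stp by (intro linked_seq) auto
    then show ?thesis using linked_reachable(2)[of a b] q a tight by auto
  next
    case False
    define f where "f = (LEAST t. q t \<notin> W)"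
    from False obtain t where t: "t \<le> n" "q t \<notin> W" by blast
    have f: "q f \<notin> W" "\<And>t. t < f \<Longrightarrow> q t \<in> W"
      unfolding f_def using LeastI[of "\<lambda>t. q t \<notin> W", OF t(2)] not_less_Least[of _ "\<lambda>t. q t \<notin> W"]
      by blast+
    have fn: "f \<le> n" using Least_le[of "\<lambda>t. q t \<notin> W", OF t(2)] t(1) unfolding f_def by linarith
    have "f \<noteq> 0" using f(1) q W_ends by metis
    then obtain f' where f': "f = Suc f'" by (cases f) auto
    define g where "g = (GREATEST t. t \<le> n \<and> q t \<notin> W)"
    have g: "g \<le> n" "q g \<notin> W"
      using GreatestI_nat[of "\<lambda>t. t \<le> n \<and> q t \<notin> W" f n] f fn unfolding g_def by auto
    have above: "q t \<in> W" if "g < t" "t \<le> n" for t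
      using Greatest_le_nat[of "\<lambda>t. t \<le> n \<and> q t \<notin> W" t n] that unfolding g_def by force
    have "g \<noteq> n" using g q W_ends by metis
    then have gn: "g < n" using g by simp
    have l1: "linked D W a (q f')"
      using linked_seq[of 0 f' q W D] q stp f f' fn by auto
    have l2: "linked D W (q (Suc g)) b"
      using linked_seq[of "Suc g" n q W D] q stp above gn by auto
    obtain i where i: "pos (q f') i"
      using bdry[of "q f'" "q f"] f f' stp[of f'] fn by auto
    obtain j where j: "pos (q (Suc g)) j"
      using bdry[of "q (Suc g)" "q g"] above[of "Suc g"] g gn stp[of g] D_sym[of "q g"] by auto
    have "q f' \<in> geo a b" "q (Suc g) \<in> geo a b" using stp[of f'] stp[of g] fn f' gn by auto
    \<comment> \<open>Both vertices are within \<open>10 * d\<close> of \<open>b\<close>. This crude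
      bound suffices because \<open>exchange\<close> gains \<open>118 * d\<close>.\<close>
    then have "D (q f') (q (Suc g)) \<le> 20 * d"
      using ab D_triangle[of "q f'" "q (Suc g)" b] D_sym[of b "q (Suc g)"]
      unfolding geo_def by simp
    then have ji: "j \<le> i + 26 * d"
      using pos_diff[of "q f'" i "3 * d" "q (Suc g)" j "3 * d"] i j unfolding pos_def by linarith
    have "reachable (q f')" "\<phi> (q f') = \<phi> a" using linked_reachable[OF l1 a] by auto
    moreover have "\<phi> (q (Suc g)) = \<phi> b"
      using linked_reachable[OF linked_sym[OF D_sym l2] b] by auto
    ultimately show ?thesis
      using exchange[of "q f'" i "q (Suc g)" j] i j ji tight assms(5) by linarith
  qed
qed

section \<open>Splitting a cheapest walk at its hops\<close>

text \<open>Abstracts a hop-free piece of a cheapest walk: the walk itself is forgotten, and each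
  vertex only remembers a tight link whose geodesic contains it. A vertex met on a free edge takes
  \<open>a = b = u\<close>.\<close>

definition blob :: "'a \<Rightarrow> 'a \<Rightarrow> 'a set \<Rightarrow> bool" where
  "blob s e S \<longleftrightarrow> reachable s \<and> reachable e \<and> s \<in> S \<and> linked D S s e \<and> \<phi> s \<le> \<phi> e \<and>
     (\<forall>u\<in>S. \<exists>a b. reachable a \<and> reachable b \<and> \<phi> s \<le> \<phi> a \<and> \<phi> b \<le> \<phi> e \<and>
        \<phi> b = \<phi> a + 7 * D a b \<and> D a b \<le> 10 * d \<and> u \<in> geo a b)"

lemma blob_single: "reachable x \<Longrightarrow> blob x x {x}"
  unfolding blob_def by (auto intro!: exI[of _ x])

lemma blob_extend:
  assumes "blob s x S" "linked D T x y" "x \<in> T" "reachable y" "\<phi> x \<le> \<phi> y"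
    and "\<And>u. u \<in> T \<Longrightarrow> \<exists>a b. reachable a \<and> reachable b \<and> \<phi> x \<le> \<phi> a \<and> \<phi> b \<le> \<phi> y \<and>
        \<phi> b = \<phi> a + 7 * D a b \<and> D a b \<le> 10 * d \<and> u \<in> geo a b"
  shows "blob s y (S \<union> T)"
proof -
  have "linked D (S \<union> T) s x" using assms(1) unfolding blob_def by (auto intro: linked_mono)
  also have "linked D (S \<union> T) x y" using assms(2) by (auto intro: linked_mono)
  finally have "linked D (S \<union> T) s y" .
  moreover have "\<exists>a b. reachable a \<and> reachable b \<and> \<phi> s \<le> \<phi> a \<and> \<phi> b \<le> \<phi> y \<and>
        \<phi> b = \<phi> a + 7 * D a b \<and> D a b \<le> 10 * d \<and> u \<in> geo a b" if "u \<in> S \<union> T" for u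
    using that
  proof
    assume "u \<in> S"
    then show ?thesis using assms(1,5) unfolding blob_def by (meson order_trans)
  next
    assume "u \<in> T"
    then show ?thesis using assms(1) assms(6)[of u] unfolding blob_def by (meson order_trans)
  qed
  ultimately show ?thesis using assms unfolding blob_def by auto
qed

text \<open>
  The walk to \<open>x\<close> split at its hops: piece \<open>S j\<close> runs from \<open>s j\<close> to \<open>e j\<close>, and the hop after it goes
  from position \<open>be j\<close> on \<open>P\<close> back to position \<open>al (Suc j)\<close>.
\<close>

definition chain ::
  "nat \<Rightarrow> (nat \<Rightarrow> 'a) \<Rightarrow> (nat \<Rightarrow> 'a) \<Rightarrow> (nat \<Rightarrow> nat) \<Rightarrow> (nat \<Rightarrow> nat) \<Rightarrow> (nat \<Rightarrow> 'a set) \<Rightarrow> 'a \<Rightarrow> bool"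
  where "chain k s e al be S x \<longleftrightarrow>
     s 0 \<in> X \<and> e k = x \<and> (\<forall>j\<le>k. blob (s j) (e j) (S j)) \<and>
     (\<forall>j<k. pos (e j) (be j) \<and> pos (s (Suc j)) (al (Suc j)) \<and>
        \<phi> (s (Suc j)) = \<phi> (e j) + (14 * d + (21 * d + al (Suc j) - be j)))"

text \<open>A walk of price \<open>\<phi> x\<close> has only cheapest prefixes, so all its moves are
  tight. Free edges and links extend the current blob, and a hop opens a new one.\<close>

lemma chain_exists:
  assumes "reach n x" "n = \<phi> x"
  shows "\<exists>k s e al be S. chain k s e al be S x"
  using assms
proof induction
  case (start x)
  then have "chain 0 (\<lambda>_. x) (\<lambda>_. x) (\<lambda>_. 0) (\<lambda>_. 0) (\<lambda>_. {x}) x"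
    using blob_single[OF \<phi>_X(1)] by (auto simp: chain_def)
  then show ?case by blast
next
  case (step n x y c)
  have rx: "reachable x" using step.hyps reachable_def by auto
  have ry: "reachable y" and "\<phi> y \<le> \<phi> x + c" using move_reachable[OF rx step.hyps(2)] by auto
  then have n: "n = \<phi> x" and y: "\<phi> y = \<phi> x + c"
    using step.prems \<phi>_le[OF step.hyps(1)] by auto
  from step.IH[OF n] obtain k s e al be S where ch: "chain k s e al be S x" by blast
  have extend: ?case
    if T: "linked D T x y" "x \<in> T" "\<And>u. u \<in> T \<Longrightarrow> \<exists>a b. reachable a \<and> reachable b \<and> \<phi> x \<le> \<phi> a \<and>
        \<phi> b \<le> \<phi> y \<and> \<phi> b = \<phi> a + 7 * D a b \<and> D a b \<le> 10 * d \<and> u \<in> geo a b" for T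
  proof -
    have "blob (s k) y (S k \<union> T)"
      using blob_extend[of "s k" x "S k" T y] T ry y ch unfolding chain_def by auto
    then have "chain k s (e(k := y)) al be (S(k := S k \<union> T)) y"
      using ch unfolding chain_def by auto
    then show ?case by blast
  qed
  from step.hyps(2) show ?case
  proof cases
    case edge
    then have "\<phi> x = \<phi> y" using y by simp
    show ?thesis
    proof (rule extend[of "{x, y}"])
      fix u assume "u \<in> {x, y}"
      then show "\<exists>a b. reachable a \<and> reachable b \<and> \<phi> x \<le> \<phi> a \<and> \<phi> b \<le> \<phi> y \<and>
          \<phi> b = \<phi> a + 7 * D a b \<and> D a b \<le> 10 * d \<and> u \<in> geo a b"
        using \<open>\<phi> x = \<phi> y\<close> rx ry by (intro exI[of _ u]) auto
    qed (use edge in \<open>auto intro: linked_step\<close>)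
  next
    case link
    then show ?thesis
      using rx ry y bound
      by (intro extend[of "geo x y"] linked_geo exI[of _ x] exI[of _ y]) auto
  next
    case (hop b a)
    have "chain (Suc k) (s(Suc k := y)) (e(Suc k := y)) (al(Suc k := a)) (be(k := b))
        (S(Suc k := {y})) y"
      using ch hop y blob_single[OF ry] unfolding chain_def
      by (auto simp: less_Suc_eq le_Suc_eq)
    then show ?thesis by blast
  qed
qed

lemma blob_witness:
  assumes "blob s e S" "\<phi> e \<le> opt" "u \<in> S"
  obtains a b where "reachable a" "reachable b" "\<phi> s \<le> \<phi> a" "\<phi> b \<le> \<phi> e"
    "\<phi> b = \<phi> a + 7 * (D a u + D u b)" "D a u + D u b \<le> 4 * d"
proof -
  obtain a b where ab: "reachable a" "reachable b" "\<phi> s \<le> \<phi> a" "\<phi> b \<le> \<phi> e"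
        "\<phi> b = \<phi> a + 7 * D a b" "D a b \<le> 10 * d" "u \<in> geo a b"
    using assms unfolding blob_def by blast
  moreover have "D a b \<le> 4 * d" using link_short[of a b] ab assms(2) by auto
  ultimately show thesis using that[of a b] by (simp add: geo_def)
qed

section \<open>Distances between pieces, path and descents\<close>

lemma link_le:
  assumes "reachable x" "reachable y" "D x y \<le> 10 * d"
  shows "\<phi> y \<le> \<phi> x + 7 * D x y"
  using move_reachable(2)[OF assms(1) link] reachable_W assms by blast

text \<open>One end of the link covering \<open>w\<close> is within \<open>2 * d\<close> of
  \<open>w\<close>, and it lies in \<open>W\<close>.\<close>

lemma blob_far_path:
  assumes "blob s e S" "\<phi> e \<le> opt" "w \<in> S" "i \<le> L"
  shows "d \<le> D w (p i)"
proof -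
  obtain a b where ab: "reachable a" "reachable b" "D a w + D w b \<le> 4 * d"
    using blob_witness[OF assms(1-3)] by metis
  then show ?thesis
    using WD[OF reachable_W[OF ab(1)] assms(4)] WD[OF reachable_W[OF ab(2)] assms(4)]
      D_triangle[of a "p i" w] D_triangle[of b "p i" w] D_sym[of b w] by linarith
qed

text \<open>Otherwise the route from \<open>a\<close> through \<open>u\<close> and \<open>w\<close>
  to \<open>b'\<close> is short enough for a link. The parts of the two tight links before
  \<open>u\<close> and after \<open>w\<close> cancel in the comparison of costs, leaving
  \<open>14 * d \<le> 7 * D u w\<close>, which is absurd.\<close>

lemma blob_far_blob:
  assumes "blob s e S" "blob s' e' S'" "\<phi> e + 14 * d \<le> \<phi> s'" "\<phi> e' \<le> opt" "u \<in> S" "w \<in> S'"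
  shows "d \<le> D u w"
proof (rule ccontr)
  assume "\<not> ?thesis"
  then have near: "D u w < d" by simp
  have "\<phi> s' \<le> \<phi> e'" using assms(2) by (simp add: blob_def)
  then have "\<phi> e \<le> opt" using assms by linarith
  obtain a b where ab: "reachable a" "\<phi> b \<le> \<phi> e"
    "\<phi> b = \<phi> a + 7 * (D a u + D u b)" "D a u + D u b \<le> 4 * d"
    using blob_witness[OF assms(1) \<open>\<phi> e \<le> opt\<close> assms(5)] by metis
  obtain a' b' where ab': "reachable b'" "\<phi> s' \<le> \<phi> a'"
    "\<phi> b' = \<phi> a' + 7 * (D a' w + D w b')" "D a' w + D w b' \<le> 4 * d"
    using blob_witness[OF assms(2,4,6)] by metis
  have tri: "D a b' \<le> D a u + D u w + D w b'"
    using D_triangle[of a b' u] D_triangle[of u b' w] by linarith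
  then have "D a b' \<le> 10 * d" using ab ab' near by linarith
  from link_le[OF ab(1) ab'(1) this] tri ab ab' assms(3) near show False by simp
qed

text \<open>
  If the descent point \<open>u\<close> is close to \<open>w\<close>, then \<open>u\<close> lies high up, because \<open>w\<close> does; so \<open>x\<close> is close
  to \<open>w\<close> and can be linked to the other blob.
\<close>

lemma descent_near:
  assumes "pos x i" "u \<in> geo x (p i)" "c \<in> W"
  shows "D x u \<le> D c w + D u w"
  using assms WD[of c i] D_triangle[of c "p i" w] D_triangle[of w "p i" u] D_sym[of w u]
  by (auto simp: pos_def geo_def)

lemma descent_far_later_blob:
  assumes "reachable x" "pos x i" "u \<in> geo x (p i)"
    and "blob s e S" "\<phi> x + 14 * d \<le> \<phi> s" "\<phi> e \<le> opt" "w \<in> S"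
  shows "d \<le> D u w"
proof (rule ccontr)
  assume "\<not> ?thesis"
  then have near: "D u w < d" by simp
  obtain a b where ab: "reachable a" "reachable b" "\<phi> s \<le> \<phi> a"
    "\<phi> b = \<phi> a + 7 * (D a w + D w b)" "D a w + D w b \<le> 4 * d"
    using blob_witness[OF assms(4,6,7)] by metis
  have "D x u \<le> D a w + D u w"
    using descent_near[OF assms(2,3)] reachable_W[OF ab(1)] by blast
  then have tri: "D x b \<le> D a w + D w b + 2 * D u w"
    using D_triangle[of x b u] D_triangle[of u b w] by linarith
  then have "D x b \<le> 10 * d" using ab near by linarith
  \<comment> \<open>The detour counts \<open>D u w\<close> twice, so it adds less than
    \<open>14 * d\<close> to the cost: the fixed price of a hop is just large enough.\<close>
  from link_le[OF assms(1) ab(2) this] tri ab assms(5) near show False by simp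
qed

text \<open>The same estimate with the link running from the blob to \<open>x\<close>.\<close>

lemma descent_far_earlier_blob:
  assumes "reachable x" "pos x i" "u \<in> geo x (p i)"
    and "blob s e S" "\<phi> e + 14 * d \<le> \<phi> x" "\<phi> e \<le> opt" "w \<in> S"
  shows "d \<le> D u w"
proof (rule ccontr)
  assume "\<not> ?thesis"
  then have near: "D u w < d" by simp
  obtain a b where ab: "reachable a" "reachable b" "\<phi> b \<le> \<phi> e"
    "\<phi> b = \<phi> a + 7 * (D a w + D w b)" "D a w + D w b \<le> 4 * d"
    using blob_witness[OF assms(4,6,7)] by metis
  have "D x u \<le> D b w + D u w"
    using descent_near[OF assms(2,3)] reachable_W[OF ab(2)] by blast
  then have tri: "D a x \<le> D a w + D w b + 2 * D u w"
    using D_triangle[of a x u] D_triangle[of a u w] D_sym[of u w] D_sym[of u x] D_sym[of b w]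
    by linarith
  then have "D a x \<le> 10 * d" using ab near by linarith
  from link_le[OF ab(1) assms(1) this] tri ab assms(5) near show False by simp
qed

section \<open>Assembling the two connected sets\<close>

lemma two_linked_sets:
  obtains A B where "\<forall>a\<in>A. \<forall>b\<in>B. d \<le> D a b"
    "\<exists>x\<in>X \<inter> A. \<exists>y\<in>Y. linked D A x y" "\<exists>x\<in>X \<inter> B. \<exists>y\<in>Y. linked D B x y"
proof -
  obtain y where y: "y \<in> Y" "reachable y" "\<phi> y = opt" using opt_attained by blast
  obtain k s e al be S where ch: "chain k s e al be S y"
    using chain_exists[OF reach_\<phi>[OF y(2)] refl] by blast
  have sX: "s 0 \<in> X" and ek: "e k = y" and bl: "\<And>j. j \<le> k \<Longrightarrow> blob (s j) (e j) (S j)"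
    and pe: "\<And>j. j < k \<Longrightarrow> pos (e j) (be j)"
    and ps: "\<And>j. j < k \<Longrightarrow> pos (s (Suc j)) (al (Suc j))"
    and hp: "\<And>j. j < k \<Longrightarrow> \<phi> (s (Suc j)) = \<phi> (e j) + (14 * d + (21 * d + al (Suc j) - be j))"
    using ch unfolding chain_def by auto
  have se: "\<phi> (s j) \<le> \<phi> (e j)" and rs: "reachable (s j)" and re: "reachable (e j)"
    if "j \<le> k" for j
    using bl[OF that] by (auto simp: blob_def)
  have gap: "\<phi> (e j) + 14 * d \<le> \<phi> (s i)" if "j < i" "i \<le> k" for i j
    using that
  proof (induction i)
    case (Suc i)
    then show ?case using hp[of i] se[of i] by (cases "j = i") auto
  qed simp
  have e_opt: "\<phi> (e j) \<le> opt" if "j \<le> k" for j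
    using gap[of j k] se[of k] that ek y(3) by (cases "j = k") auto
  have s_opt: "\<phi> (s j) \<le> opt" if "j \<le> k" for j
    using se[OF that] e_opt[OF that] by linarith
  \<comment> \<open>Any descent may be combined with any ascent. Comparing such a hop with the
    actual route yields all the ordering facts below.\<close>
  have jump: "\<phi> (s (Suc i)) \<le> \<phi> (e j) + (14 * d + (21 * d + al (Suc i) - be j))"
    if "j < k" "i < k" for i j
    using move_reachable(2)[OF re hop[OF pe[of j] ps[of i]]] that by auto
  have overlap: "al (Suc j) + 7 * d \<le> be j" if "j < k" for j
    using hop_overlap[OF re pe ps hp s_opt, of j] that by auto
  \<comment> \<open>Skipping one piece saves \<open>14 * d\<close>, so the penalty of the skipping
    hop must be larger than the two actual penalties together by at least that much.\<close>
  have two: "be j + 14 * d \<le> be (Suc j)" "al (Suc j) + 14 * d \<le> al (Suc (Suc j))"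
    if "Suc j < k" for j
  proof -
    have "j < k" "Suc j \<le> k" using that by auto
    note * = jump[OF this(1) that] hp[OF this(1)] hp[OF that] se[OF this(2)] d_pos
    show "be j + 14 * d \<le> be (Suc j)" "al (Suc j) + 14 * d \<le> al (Suc (Suc j))"
      using * by linarith+
  qed
  \<comment> \<open>Skipping two pieces saves \<open>28 * d\<close>, which exceeds the penalty
    threshold \<open>21 * d\<close> by \<open>7 * d\<close>.\<close>
  have three: "be j + 7 * d \<le> al (Suc (Suc (Suc j)))" if "Suc (Suc j) < k" for j
  proof -
    have "j < k" "Suc j < k" "Suc j \<le> k" "Suc (Suc j) \<le> k" using that by auto
    then show ?thesis
      using jump[OF \<open>j < k\<close> that] hp[of j] hp[of "Suc j"] hp[OF that] se[of "Suc j"]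
        se[of "Suc (Suc j)"] d_pos by simp
  qed
  have be_mono: "be i \<le> be j \<and> (i \<noteq> j \<longrightarrow> be i + 14 * d \<le> be j)" if "i \<le> j" "j < k" for i j
    using that
  proof (induction j rule: dec_induct)
    case (step n)
    then show ?case using two(1)[of n] by auto
  qed simp
  have al_mono: "al (Suc i) \<le> al (Suc j) \<and> (i \<noteq> j \<longrightarrow> al (Suc i) + 14 * d \<le> al (Suc j))"
    if "i \<le> j" "j < k" for i j
    using that
  proof (induction j rule: dec_induct)
    case (step n)
    then show ?case using two(2)[of n] by auto
  qed simp
  \<comment> \<open>The segment under piece \<open>j\<close> runs from the descent before it to the
    ascent after it; at the two ends of the walk the ends of the path take over.\<close>
  define lft where "lft j = (if j = 0 then 0 else be (j - 1))" for j
  define rgt where "rgt j = (if j = k then L else al (Suc j))" for j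
  have lftL: "lft j \<le> L" if "j \<le> k" for j
    using pe[of "j - 1"] that by (auto simp: lft_def pos_def)
  have rgtL: "rgt j \<le> L" if "j \<le> k" for j
    using ps[of j] that by (auto simp: rgt_def pos_def)
  \<comment> \<open>Either order of the two ends is possible, so the segment may be traversed
    backwards.\<close>
  define seg where "seg j = {min (lft j) (rgt j)..max (lft j) (rgt j)}" for j
  \<comment> \<open>It suffices to compare ends: \<open>RL\<close> comes from the overlap of hops,
    \<open>LL\<close> and \<open>RR\<close> from monotonicity, and \<open>LR\<close> from
    \<open>three\<close>.\<close>
  have order: "m + 7 * d \<le> n" if "i < j" "j \<le> k" "m \<in> seg i" "n \<in> seg j" for i j m n
  proof -
    obtain j' where j': "j = Suc j'" using \<open>i < j\<close> by (cases j) auto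
    have ri: "rgt i = al (Suc i)" and lj: "lft j = be j'"
      using that j' by (auto simp: rgt_def lft_def)
    have RL: "rgt i + 7 * d \<le> lft j"
      using overlap[of i] be_mono[of i j'] that j' unfolding ri lj by auto
    have LL: "lft i + 7 * d \<le> lft j"
    proof (cases i)
      case (Suc i')
      then show ?thesis using be_mono[of i' j'] that Suc j' unfolding lj by (auto simp: lft_def)
    qed (use RL in \<open>simp add: lft_def\<close>)
    have RR: "rgt i + 7 * d \<le> rgt j"
    proof (cases "j = k")
      case False
      then show ?thesis using al_mono[of i j] that False unfolding ri by (auto simp: rgt_def)
    qed (use RL lftL[of j] that in \<open>simp add: rgt_def\<close>)
    have LR: "lft i + 7 * d \<le> rgt j"
    proof (cases "j = k \<or> i = 0")
      case True
      then show ?thesis using LL RR lftL[of j] that by (auto simp: rgt_def lft_def)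
    next
      case False
      then obtain i' where i': "i = Suc i'" by (cases i) auto
      have "be i' + 7 * d \<le> al (Suc (Suc (Suc i')))" using three[of i'] i' that False by auto
      moreover have "al (Suc (Suc (Suc i'))) \<le> al (Suc j)"
        using al_mono[of "Suc (Suc i')" j] that i' False by auto
      ultimately show ?thesis using i' False by (auto simp: lft_def rgt_def)
    qed
    show ?thesis using RL LL RR LR that(3,4) unfolding seg_def by auto
  qed
  define desc where "desc j = (if j = 0 then {} else geo (e (j - 1)) (p (lft j))) \<union>
      (if j = k then {} else geo (s (Suc j)) (p (rgt j)))" for j
  define E where "E j = p ` seg j \<union> desc j" for j
  \<comment> \<open>\<open>E j\<close> joins the end of piece \<open>j - 1\<close> to the start of
    piece \<open>Suc j\<close>, so it goes with the parity opposite to \<open>j\<close>.\<close>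
  define A where "A c = \<Union>(S ` {j. j \<le> k \<and> j mod 2 = c}) \<union> \<Union>(E ` {j. j \<le> k \<and> j mod 2 \<noteq> c})"
    for c :: nat
  have seg_ends: "lft j \<in> seg j" "rgt j \<in> seg j" for j by (auto simp: seg_def)
  have segL: "m \<le> L" if "m \<in> seg j" "j \<le> k" for m j
    using that lftL[of j] rgtL[of j] unfolding seg_def by auto
  have E_near: "\<exists>m\<in>seg j. D u (p m) \<le> 3 * d" if "u \<in> E j" "j \<le> k" for u j
  proof -
    have "D u (p m) \<le> 3 * d" if "pos x m" "u \<in> geo x (p m)" for x m
      using that by (auto simp: geo_def pos_def)
    moreover have "pos (e (j - 1)) (lft j)" if "j \<noteq> 0"
      using pe[of "j - 1"] that \<open>j \<le> k\<close> by (auto simp: lft_def)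
    moreover have "pos (s (Suc j)) (rgt j)" if "j \<noteq> k"
      using ps[of j] that \<open>j \<le> k\<close> by (auto simp: rgt_def)
    moreover have "\<exists>m\<in>seg j. D u (p m) \<le> 3 * d" if "u \<in> p ` seg j"
      using that by (auto intro!: bexI[of _ _ "seg j"])
    ultimately show ?thesis
      using \<open>u \<in> E j\<close> seg_ends[of j] unfolding E_def desc_def by (auto split: if_splits)
  qed
  \<comment> \<open>Segments are \<open>7 * d\<close> apart and each side strays at most
    \<open>3 * d\<close> from its segment, which leaves \<open>d\<close>.\<close>
  have EE: "d \<le> D u w" if EE: "i < j" "j \<le> k" "u \<in> E i" "w \<in> E j" for i j u w
  proof -
    obtain m where m: "m \<in> seg i" "D u (p m) \<le> 3 * d" using E_near[of u i] EE by auto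
    obtain n where n: "n \<in> seg j" "D w (p n) \<le> 3 * d" using E_near[of w j] EE by auto
    have "m + 7 * d \<le> n" using order[of i j m n] that m n by auto
    then show ?thesis
      using pos_diff[of u m "3 * d" w n "3 * d"] segL[of m i] segL[of n j] m n that by linarith
  qed
  have SS: "d \<le> D u w" if "i < j" "j \<le> k" "u \<in> S i" "w \<in> S j" for i j u w
    using blob_far_blob[OF bl[of i] bl[of j] gap e_opt] that by auto
  have SE: "d \<le> D u w" if "i \<le> k" "j \<le> k" "i mod 2 = j mod 2" "u \<in> S i" "w \<in> E j" for i j u w
  proof -
    \<comment> \<open>Equal parity keeps \<open>S i\<close> different from the two pieces in which
      the descents of \<open>E j\<close> begin, so at least one hop separates them.\<close>
    have "Suc n mod 2 \<noteq> n mod 2" for n :: nat by presburger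
    then have opp: "i \<noteq> Suc j" "i \<noteq> j - 1 \<or> j = 0"
      using that(3) by (metis, metis Suc_pred' neq0_conv)
    consider m where "m \<in> seg j" "w = p m"
      | "j \<noteq> 0" "w \<in> geo (e (j - 1)) (p (lft j))" | "j \<noteq> k" "w \<in> geo (s (Suc j)) (p (rgt j))"
      using \<open>w \<in> E j\<close> unfolding E_def desc_def by (auto split: if_splits)
    then have "d \<le> D w u"
    proof cases
      case 1
      then show ?thesis
        using blob_far_path[OF bl e_opt that(4), of m] segL[of m j] that D_sym[of u w] by auto
    next
      case 2
      have ps': "pos (e (j - 1)) (lft j)" using pe[of "j - 1"] 2 that by (auto simp: lft_def)
      have r: "reachable (e (j - 1))" using re that by simp
      show ?thesis
      proof (cases "i < j - 1")
        case True
        have "\<phi> (e i) + 14 * d \<le> \<phi> (e (j - 1))"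
          using gap[of i "j - 1"] se[of "j - 1"] True that by linarith
        then show ?thesis
          using descent_far_earlier_blob[OF r ps' 2(2) bl[OF that(1)]] e_opt that by auto
      next
        case False
        then have "j - 1 < i" using opp 2 by auto
        then show ?thesis
          using descent_far_later_blob[OF r ps' 2(2) bl[OF that(1)]] gap[of "j - 1" i] e_opt that
          by auto
      qed
    next
      case 3
      have ps': "pos (s (Suc j)) (rgt j)" using ps[of j] 3 that by (auto simp: rgt_def)
      have jk: "Suc j \<le> k" using 3 that by simp
      have r: "reachable (s (Suc j))" using rs jk by simp
      show ?thesis
      proof (cases "i < Suc j")
        case True
        then show ?thesis
          using descent_far_earlier_blob[OF r ps' 3(2) bl[OF that(1)]] gap[of i "Suc j"] e_opt that jk
          by auto
      next
        case False
        then have "Suc j < i" using opp by auto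
        then have "\<phi> (s (Suc j)) + 14 * d \<le> \<phi> (s i)"
          using gap[of "Suc j" i] se[OF jk] that by linarith
        then show ?thesis
          using descent_far_later_blob[OF r ps' 3(2) bl[OF that(1)]] e_opt that by auto
      qed
    qed
    then show ?thesis by (simp add: D_sym)
  qed
  have far: "d \<le> D a b" if ab: "a \<in> A 0" "b \<in> A 1" for a b
  proof -
    have mem: "(\<exists>i\<le>k. i mod 2 = c \<and> u \<in> S i) \<or> (\<exists>i\<le>k. i mod 2 \<noteq> c \<and> u \<in> E i)"
      if "u \<in> A c" for u c
      using that unfolding A_def by blast
    consider i j where "i \<le> k" "j \<le> k" "i mod 2 = 0" "j mod 2 = 1" "a \<in> S i" "b \<in> S j"
      | i j where "i \<le> k" "j \<le> k" "i mod 2 = 0" "j mod 2 \<noteq> 1" "a \<in> S i" "b \<in> E j"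
      | i j where "i \<le> k" "j \<le> k" "i mod 2 \<noteq> 0" "j mod 2 = 1" "a \<in> E i" "b \<in> S j"
      | i j where "i \<le> k" "j \<le> k" "i mod 2 \<noteq> 0" "j mod 2 \<noteq> 1" "a \<in> E i" "b \<in> E j"
      using mem[OF ab(1)] mem[OF ab(2)] by metis
    then show ?thesis
    proof cases
      case 1
      then show ?thesis
        using SS[of i j a b] SS[of j i b a] D_sym[of a b] by (cases i j rule: linorder_cases) auto
    next
      case 2
      then show ?thesis using SE[of i j a b] by auto
    next
      case 3
      then show ?thesis using SE[of j i b a] D_sym[of a b] by auto
    next
      case 4
      then show ?thesis
        using EE[of i j a b] EE[of j i b a] D_sym[of a b] by (cases i j rule: linorder_cases) auto
    qed
  qed
  have SA: "S j \<subseteq> A (j mod 2)" if "j \<le> k" for j using that unfolding A_def by blast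
  have EA: "E j \<subseteq> A (Suc j mod 2)" if "j \<le> k" for j
  proof -
    have "j mod 2 \<noteq> Suc j mod 2" by presburger
    then show ?thesis using that unfolding A_def by blast
  qed
  have run_seg: "linked D (p ` seg j) (p (lft j)) (p (rgt j))" if "j \<le> k" for j
  proof -
    have *: "linked D (p ` {m..n}) (p m) (p n)" if "m \<le> n" "n \<le> L" for m n
      using that by (intro linked_seq) (auto simp: D_p)
    show ?thesis
    proof (cases "lft j \<le> rgt j")
      case True
      then show ?thesis using * rgtL[OF that] by (auto simp: seg_def)
    next
      case False
      then show ?thesis
        using linked_sym[OF D_sym *[of "rgt j" "lft j"]] lftL[OF that] by (auto simp: seg_def)
    qed
  qed
  have run_geo: "linked D (geo x (p m)) x (p m)" "linked D (geo x (p m)) (p m) x" if "pos x m" for x m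
  proof -
    show "linked D (geo x (p m)) x (p m)"
      using that bound by (intro linked_geo) (auto simp: pos_def)
    then show "linked D (geo x (p m)) (p m) x" by (rule linked_sym[OF D_sym])
  qed
  \<comment> \<open>At each stage one set has arrived at the end of piece \<open>j\<close> and the
    other at the end of the segment below it. In the induction step they swap roles: one climbs to
    the next piece, the other descends to the next segment.\<close>
  have runs: "(\<exists>x\<in>X \<inter> A (j mod 2). linked D (A (j mod 2)) x (e j)) \<and>
      (\<exists>x\<in>X \<inter> A (Suc j mod 2). linked D (A (Suc j mod 2)) x (p (rgt j)))" if "j \<le> k" for j
    using that
  proof (induction j)
    case 0
    have "s 0 \<in> A 0" "linked D (A 0) (s 0) (e 0)"
      using bl[of 0] SA[of 0] linked_mono[of D "S 0" "s 0" "e 0" "A 0"] by (auto simp: blob_def)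
    moreover have "linked D (A 1) (p 0) (p (rgt 0))"
      using linked_mono[OF run_seg[of 0], of "A 1"] EA[of 0] by (auto simp: E_def lft_def)
    moreover have "p 0 \<in> A 1" using EA[of 0] seg_ends(1)[of 0] by (auto simp: E_def lft_def)
    ultimately show ?case using sX p_X by auto
  next
    case (Suc j)
    then have jk: "j < k" by simp
    define c c' where c: "c = j mod 2" "c' = Suc j mod 2"
    have cc: "Suc (Suc j) mod 2 = c" unfolding c by presburger
    have sub: "E j \<subseteq> A c'" "S (Suc j) \<subseteq> A c'" "E (Suc j) \<subseteq> A c"
      using EA[of j] SA[of "Suc j"] EA[of "Suc j"] jk unfolding cc c by simp_all
    obtain x x' where x: "x \<in> X \<inter> A c" "linked D (A c) x (e j)"
      and x': "x' \<in> X \<inter> A c'" "linked D (A c') x' (p (rgt j))"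
      using Suc.IH jk unfolding c by (meson less_imp_le_nat)
    have ps': "pos (s (Suc j)) (rgt j)" using ps[OF jk] jk by (simp add: rgt_def)
    have pe': "pos (e j) (lft (Suc j))" using pe[OF jk] by (simp add: lft_def)
    note x'(2)
    also have "geo (s (Suc j)) (p (rgt j)) \<subseteq> A c'"
      using sub(1) jk unfolding E_def desc_def by auto
    then have "linked D (A c') (p (rgt j)) (s (Suc j))"
      using run_geo(2)[OF ps'] linked_mono by metis
    also have "linked D (A c') (s (Suc j)) (e (Suc j))"
      using bl[of "Suc j"] sub(2) jk linked_mono unfolding blob_def by (metis Suc_leI)
    finally have 1: "linked D (A c') x' (e (Suc j))" .
    note x(2)
    also have "geo (e j) (p (lft (Suc j))) \<subseteq> A c"
      using sub(3) unfolding E_def desc_def by auto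
    then have "linked D (A c) (e j) (p (lft (Suc j)))"
      using run_geo(1)[OF pe'] linked_mono by metis
    also have "p ` seg (Suc j) \<subseteq> A c" using sub(3) unfolding E_def by auto
    then have "linked D (A c) (p (lft (Suc j))) (p (rgt (Suc j)))"
      using run_seg[of "Suc j"] jk linked_mono by (metis Suc_leI)
    finally have 2: "linked D (A c) x (p (rgt (Suc j)))" .
    show ?case using 1 2 x(1) x'(1) unfolding cc c(2)[symmetric] by blast
  qed
  have "\<exists>x\<in>X \<inter> A c. \<exists>y\<in>Y. linked D (A c) x y" if "c < 2" for c
  proof (cases "c = k mod 2")
    case True
    then show ?thesis using runs[of k] ek y(1) by auto
  next
    case False
    then have "c = Suc k mod 2" using that by presburger
    then show ?thesis using runs[of k] p_Y by (auto simp: rgt_def)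
  qed
  then show thesis using that[of "A 0" "A 1"] far by auto
qed

end

section \<open>Truncated distances and walks in graphs\<close>

text \<open>Truncation at \<open>B\<close> makes the distance finite while keeping the triangle inequality.\<close>

definition tdist :: "('a \<times> 'a) set \<Rightarrow> nat \<Rightarrow> 'a \<Rightarrow> 'a \<Rightarrow> nat" where
  "tdist R B u v = (LEAST n. n = B \<or> (u, v) \<in> R ^^ n)"

lemma tdist_le: "(u, v) \<in> R ^^ n \<Longrightarrow> tdist R B u v \<le> n"
  unfolding tdist_def by (rule Least_le) simp

lemma tdist_le_bound: "tdist R B u v \<le> B"
  unfolding tdist_def by (rule Least_le) simp

lemma tdist_cases: "tdist R B u v = B \<or> (u, v) \<in> R ^^ tdist R B u v"
  unfolding tdist_def by (rule LeastI[of _ B]) simp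

lemma tdist_refl: "tdist R B u u = 0"
  using tdist_le[of u u 0 R B] by simp

lemma tdist_triangle: "tdist R B u w \<le> tdist R B u v + tdist R B v w"
proof (cases "tdist R B u v = B \<or> tdist R B v w = B")
  case False
  then have "(u, w) \<in> R ^^ (tdist R B u v + tdist R B v w)"
    using tdist_cases[of R B u v] tdist_cases[of R B v w] by (auto simp: relpow_add)
  then show ?thesis by (rule tdist_le)
qed (use tdist_le_bound[of R B u w] in auto)

lemma sym_relpow: "sym R \<Longrightarrow> (u, v) \<in> R ^^ n \<Longrightarrow> (v, u) \<in> R ^^ n"
proof (induction n arbitrary: v)
  case (Suc n)
  then obtain w where "(u, w) \<in> R ^^ n" "(w, v) \<in> R" by auto
  then show ?case using Suc by (meson relpow_Suc_I2 symD)
qed simp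

lemma tdist_sym: "sym R \<Longrightarrow> tdist R B u v = tdist R B v u"
  unfolding tdist_def by (metis sym_relpow)

lemma tdist_geodesic:
  assumes "tdist R B u v = Suc n" "Suc n < B"
  shows "\<exists>w. tdist R B u w \<le> 1 \<and> tdist R B w v = n"
proof -
  have "(u, v) \<in> R ^^ Suc n" using tdist_cases[of R B u v] assms by auto
  then obtain w where w: "(u, w) \<in> R" "(w, v) \<in> R ^^ n" by (meson relpow_Suc_D2)
  have "tdist R B u w \<le> 1" using w(1) tdist_le[of u w 1 R B] by simp
  moreover have "tdist R B w v \<le> n" using w(2) by (rule tdist_le)
  ultimately show ?thesis
    using assms(1) tdist_triangle[of R B u v w] by (intro exI[of _ w]) auto
qed

lemma tdist_le_1: "tdist R B u v \<le> 1 \<Longrightarrow> 1 < B \<Longrightarrow> u = v \<or> (u, v) \<in> R"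
  using tdist_cases[of R B u v] by (cases "tdist R B u v") auto

lemma vwalk_nth_arc:
  assumes "vwalk q G" "Suc t < length q"
  shows "(q ! t, q ! Suc t) \<in> arcs_ends G"
  using assms
proof (induction arbitrary: t rule: vwalk_induct)
  case (Cons u v es)
  then show ?case by (cases t) auto
qed simp

lemma vwalk_relpow: "vwalk q G \<Longrightarrow> (hd q, last q) \<in> arcs_ends G ^^ (length q - 1)"
proof (induction rule: vwalk_induct)
  case (Cons u v es)
  then have "(u, last (v # es)) \<in> arcs_ends G ^^ Suc (length es)"
    by (intro relpow_Suc_I2[of u v]) auto
  then show ?case by simp
qed simp

lemma (in wf_digraph) relpow_vwalk:
  assumes "(u, v) \<in> arcs_ends G ^^ n" "v \<in> verts G"
  shows "\<exists>q. vwalk q G \<and> hd q = u \<and> last q = v \<and> length q = Suc n"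
  using assms
proof (induction n arbitrary: u)
  case 0
  then show ?case by (intro exI[of _ "[v]"]) auto
next
  case (Suc n)
  then obtain w where w: "(u, w) \<in> arcs_ends G" "(w, v) \<in> arcs_ends G ^^ n"
    by (meson relpow_Suc_D2)
  then obtain q where q: "vwalk q G" "hd q = w" "last q = v" "length q = Suc n"
    using Suc by blast
  then have "vwalk (u # q) G" using w by (intro vwalk_wf_digraph_consI) auto
  then show ?case using q by (intro exI[of _ "u # q"]) auto
qed

lemma length_vwalk_to_vpath: "length (vwalk_to_vpath q) \<le> length q"
proof (induction q rule: vwalk_to_vpath_induct3)
  case (in_set x xs)
  then show ?case using length_dropWhile_le[of "\<lambda>y. y \<noteq> x" xs] by simp
qed auto

lemma (in wf_digraph) vdist_le_relpow:
  assumes "(u, v) \<in> arcs_ends G ^^ n" "v \<in> verts G"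
  shows "vdist G u v \<le> enat n"
proof -
  obtain q where q: "vwalk q G" "hd q = u" "last q = v" "length q = Suc n"
    using relpow_vwalk[OF assms] by blast
  have "vdist G u v \<le> enat (vwalk_length (vwalk_to_vpath q))"
    unfolding vdist_def using q
    by (intro INF_lower) (auto simp: vwalk_to_vpath_vpath vwalk_to_vpath_hd vwalk_to_vpath_last)
  also have "\<dots> \<le> enat n" using length_vwalk_to_vpath[of q] q(4) by simp
  finally show ?thesis .
qed

text \<open>A shortest path inside \<open>A\<close> from \<open>X\<close> to \<open>Y\<close> has no
  internal vertex in \<open>X \<union> Y\<close>, since cutting it there would give a shorter
  one.\<close>

lemma XY_path_within:
  assumes "vwalk w G" "set w \<subseteq> A" "hd w \<in> X" "last w \<in> Y"
  shows "\<exists>q. XY_path G X Y q \<and> set q \<subseteq> A"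
proof -
  define good where "good q \<longleftrightarrow> vpath q G \<and> set q \<subseteq> A \<and> hd q \<in> X \<and> last q \<in> Y" for q
  have "good (vwalk_to_vpath w)"
    using assms vwalk_to_vpath_subset[of _ w] unfolding good_def
    by (auto simp: vwalk_to_vpath_vpath vwalk_to_vpath_hd vwalk_to_vpath_last)
  then obtain q where q: "good q" and least: "\<And>r. good r \<Longrightarrow> length q \<le> length r"
    using ex_has_least_nat[of good _ length] by blast
  have "z \<notin> X \<union> Y" if "z \<in> internal_verts q" for z
  proof
    assume z: "z \<in> X \<union> Y"
    have "q \<noteq> []" using q unfolding good_def vpath_def by auto
    then obtain a q' where a: "q = a # q'" by (cases q) auto
    have zq: "z \<in> set (butlast q')" using that by (simp add: internal_verts_def a)
    then obtain us vs where "butlast q' = us @ z # vs" by (meson split_list)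
    moreover have "q' \<noteq> []" using zq by auto
    ultimately have q_eq: "q = (a # us) @ z # (vs @ [last q'])"
      using a append_butlast_last_id[of q'] by simp
    have walk: "vwalk q G" and dist: "distinct q" using q by (auto simp: good_def vpath_def)
    show False
    proof (cases "z \<in> X")
      case True
      have "vwalk (z # vs @ [last q']) G"
        using vwalkI_append_r[of "z # vs @ [last q']" "a # us" G] walk q_eq by simp
      then have "good (z # vs @ [last q'])"
        using q dist True unfolding good_def vpath_def q_eq by auto
      then show False using least[of "z # vs @ [last q']"] q_eq by simp
    next
      case False
      have "vwalk ((a # us) @ [z]) G"
        using vwalkI_append_l[of "(a # us) @ [z]" "vs @ [last q']" G] walk q_eq by simp
      then have "good ((a # us) @ [z])"
        using q dist False z unfolding good_def vpath_def q_eq by auto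
      then show False using least[of "(a # us) @ [z]"] q_eq by simp
    qed
  qed
  then show ?thesis using q unfolding XY_path_def good_def by blast
qed

lemma (in wf_digraph) linked_vwalk:
  assumes "linked (tdist (arcs_ends G) B) A x y" "1 < B" "x \<in> A" "x \<in> verts G"
  shows "y \<in> verts G \<and> (\<exists>w. vwalk w G \<and> set w \<subseteq> A \<and> hd w = x \<and> last w = y)"
  using assms(1) unfolding linked_def
proof (induction rule: rtranclp_induct)
  case base
  then show ?case using assms by (auto intro!: exI[of _ "[x]"])
next
  case (step y z)
  then obtain w where w: "vwalk w G" "set w \<subseteq> A" "hd w = x" "last w = y" by blast
  consider "y = z" | "(y, z) \<in> arcs_ends G" using step.hyps tdist_le_1 assms(2) by metis
  then show ?case
  proof cases
    case 1
    then show ?thesis using step.IH by simp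
  next
    case 2
    then have "z \<in> verts G" by auto
    moreover have "w \<noteq> []" using w by auto
    moreover have "vwalk (w @ [z]) G"
      using w 2 \<open>z \<in> verts G\<close> \<open>w \<noteq> []\<close> by (auto simp: vwalk_def set_vwalk_arcs_snoc)
    ultimately show ?thesis using w step.hyps by (intro conjI exI[of _ "w @ [z]"]) auto
  qed
qed

section \<open>Application to graphs\<close>

theorem theorem1p2:
  fixes G :: "('a,'b) pre_digraph" and X Y :: "'a set" and d :: nat
  assumes "graph G" and "verts G \<noteq> {}"
    and "X \<subseteq> verts G" and "Y \<subseteq> verts G"
    and "d \<ge> 1"
  shows "(\<exists>P1 P2. XY_path G X Y P1 \<and> XY_path G X Y P2 \<and> set P1 \<inter> set P2 = {} \<and>
            subgraph_dist G (set P1) (set P2) \<ge> enat d)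
       \<or> (\<exists>z \<in> verts G. \<forall>P. XY_path G X Y P \<longrightarrow> gball G z (121 * d) \<inter> set P \<noteq> {})"
proof (rule disjCI)
  interpret graph G by fact
  assume no_ball: "\<not> (\<exists>z \<in> verts G. \<forall>P. XY_path G X Y P \<longrightarrow> gball G z (121 * d) \<inter> set P \<noteq> {})"
  define R where "R = arcs_ends G"
  have symR: "sym R" using sym_arcs unfolding R_def symmetric_def .
  define joins where "joins n \<longleftrightarrow> (\<exists>x\<in>X. \<exists>y\<in>Y. (x, y) \<in> R ^^ n)" for n
  define L where "L = (LEAST n. joins n)"
  \<comment> \<open>With no path at all, any vertex would satisfy the ball alternative
    vacuously.\<close>
  obtain P0 where "XY_path G X Y P0" using no_ball assms(2) by blast
  then have "joins (length P0 - 1)"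
    using vwalk_relpow[of P0 G] unfolding XY_path_def vpath_def joins_def R_def by blast
  then have "joins L" unfolding L_def by (rule LeastI)
  then obtain p where p: "p 0 \<in> X" "p L \<in> Y" "\<And>i. i < L \<Longrightarrow> (p i, p (Suc i)) \<in> R"
    unfolding joins_def relpow_fun_conv by blast
  have L_le: "L \<le> n" if "x \<in> X" "y \<in> Y" "(x, y) \<in> R ^^ n" for x y n
    using that unfolding L_def joins_def by (intro Least_le) blast
  have p_run: "(p i, p j) \<in> R ^^ (j - i)" if "i \<le> j" "j \<le> L" for i j
    unfolding relpow_fun_conv using that p(3) by (intro exI[of _ "\<lambda>t. p (i + t)"]) auto
  have p_verts: "p i \<in> verts G" if "i \<le> L" for i
  proof (cases i)
    case (Suc m)
    then have "(p m, p i) \<in> arcs_ends G" using that p(3)[of m] by (simp add: R_def)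
    then show ?thesis by (rule adj_in_verts(2))
  qed (use p assms(3) in auto)
  \<comment> \<open>Large enough that truncation affects no comparison with \<open>L\<close>,
    \<open>10 * d\<close> or \<open>121 * d\<close>.\<close>
  define B where "B = L + 1000 * d"
  define D where "D = tdist R B"
  have D_relpow: "(u, v) \<in> R ^^ D u v" if "D u v < B" for u v
    using tdist_cases[of R B u v] that unfolding D_def by auto
  interpret coarse_strip D X Y p L d B
  proof
    show "D x x = 0" for x by (simp add: D_def tdist_refl)
    show "D x y = D y x" for x y unfolding D_def by (rule tdist_sym[OF symR])
    show "D x z \<le> D x y + D y z" for x y z unfolding D_def by (rule tdist_triangle)
    show "\<exists>z. D x z \<le> 1 \<and> D z y = n" if "D x y = Suc n" "Suc n < B" for x y n
      using tdist_geodesic that unfolding D_def by metis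
    show "10 * d < B" using \<open>d \<ge> 1\<close> by (simp add: B_def)
    \<comment> \<open>A shorter connection to \<open>p i\<close>, continued along \<open>p\<close>,
      would contradict the minimality of \<open>L\<close>.\<close>
    show X_far: "i \<le> D x (p i)" if "x \<in> X" "i \<le> L" for x i
    proof (rule ccontr)
      assume less: "\<not> ?thesis"
      then have "(x, p L) \<in> R ^^ (D x (p i) + (L - i))"
        using D_relpow[of x "p i"] p_run[of i L] that unfolding relpow_add B_def by auto
      then show False using L_le[OF that(1) p(2)] less that by fastforce
    qed
    show "L - i \<le> D y (p i)" if "y \<in> Y" "i \<le> L" for y i
    proof (rule ccontr)
      assume less: "\<not> ?thesis"
      then have "(p i, y) \<in> R ^^ D y (p i)"
        using D_relpow[of y "p i"] symR sym_relpow unfolding B_def by fastforce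
      then have "(p 0, y) \<in> R ^^ (i + D y (p i))"
        using p_run[of 0 i] that unfolding relpow_add by auto
      then show False using L_le[OF p(1) that(1)] less that by fastforce
    qed
    show "D (p i) (p j) = j - i" if "i \<le> j" "j \<le> L" for i j
    proof (rule antisym)
      show "D (p i) (p j) \<le> j - i" unfolding D_def by (rule tdist_le[OF p_run[OF that]])
      have "D (p 0) (p i) \<le> i" unfolding D_def using tdist_le[OF p_run[of 0 i]] that by simp
      then show "j - i \<le> D (p i) (p j)"
        using X_far[OF p(1), of j] that tdist_triangle[of R B "p 0" "p j" "p i"]
        unfolding D_def by linarith
    qed
    show "\<exists>q n. q 0 \<in> X \<and> q n \<in> Y \<and> (\<forall>t<n. D (q t) (q (Suc t)) \<le> 1) \<and>
        (\<forall>t\<le>n. 121 * d < D (q t) (p i))" if "i \<le> L" for i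
    proof -
      obtain Q where Q: "XY_path G X Y Q" "gball G (p i) (121 * d) \<inter> set Q = {}"
        using no_ball p_verts[OF \<open>i \<le> L\<close>] by blast
      then have walk: "vwalk Q G" and ends: "hd Q \<in> X" "last Q \<in> Y"
        by (auto simp: XY_path_def vpath_def)
      have ne: "Q \<noteq> []" using walk by auto
      have "D (Q ! t) (Q ! Suc t) \<le> 1" if "t < length Q - 1" for t
        using vwalk_nth_arc[OF walk, of t] tdist_le[of _ _ 1 R B] that unfolding D_def R_def by simp
      moreover have "121 * d < D (Q ! t) (p i)" if t: "t \<le> length Q - 1" for t
      proof (rule ccontr)
        assume "\<not> ?thesis"
        then have near: "D (Q ! t) (p i) \<le> 121 * d" by simp
        then have "(Q ! t, p i) \<in> R ^^ D (Q ! t) (p i)"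
          using \<open>d \<ge> 1\<close> by (intro D_relpow) (simp add: B_def)
        then have "vdist G (Q ! t) (p i) \<le> enat (D (Q ! t) (p i))"
          using vdist_le_relpow p_verts[OF \<open>i \<le> L\<close>] unfolding R_def by blast
        also have "\<dots> \<le> enat (121 * d)" using near by simp
        finally have "vdist G (Q ! t) (p i) \<le> enat (121 * d)" .
        moreover have "Q ! t \<in> set Q" using t ne by (intro nth_mem) (cases Q, auto)
        moreover have "Q ! t \<in> verts G" using walk calculation(2) by auto
        ultimately show False using Q(2) unfolding gball_def by blast
      qed
      ultimately show ?thesis
        using ends ne by (intro exI[of _ "(!) Q"] exI[of _ "length Q - 1"])
          (simp add: hd_conv_nth last_conv_nth)
    qed
  qed (use p \<open>d \<ge> 1\<close> in auto)
  obtain A A' where far: "\<forall>a\<in>A. \<forall>b\<in>A'. d \<le> D a b"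
    and A: "\<exists>x\<in>X \<inter> A. \<exists>y\<in>Y. linked D A x y" and A': "\<exists>x\<in>X \<inter> A'. \<exists>y\<in>Y. linked D A' x y"
    by (rule two_linked_sets)
  have path: "\<exists>P. XY_path G X Y P \<and> set P \<subseteq> S" if "\<exists>x\<in>X \<inter> S. \<exists>y\<in>Y. linked D S x y" for S
  proof -
    from that obtain x y where xy: "x \<in> X" "x \<in> S" "y \<in> Y" "linked D S x y" by blast
    have "1 < B" using \<open>d \<ge> 1\<close> by (simp add: B_def)
    then obtain w where "vwalk w G" "set w \<subseteq> S" "hd w = x" "last w = y"
      using linked_vwalk[of B S x y] xy assms(3) unfolding D_def R_def by blast
    then show ?thesis using XY_path_within xy by metis
  qed
  obtain P1 P2 where P: "XY_path G X Y P1" "set P1 \<subseteq> A" "XY_path G X Y P2" "set P2 \<subseteq> A'"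
    using path[OF A] path[OF A'] by blast
  have disj: "set P1 \<inter> set P2 = {}"
    using far P \<open>d \<ge> 1\<close> D_refl by fastforce
  have "enat d \<le> subgraph_dist G (set P1) (set P2)"
    unfolding subgraph_dist_def
  proof (rule INF_greatest)
    fix q assume "q \<in> {q. XY_path G (set P1) (set P2) q}"
    then have q: "vwalk q G" "hd q \<in> A" "last q \<in> A'" using P by (auto simp: XY_path_def vpath_def)
    \<comment> \<open>Truncation only lowers distances, so a lower bound on \<open>D\<close> still
      bounds the length of \<open>q\<close>.\<close>
    have "d \<le> D (hd q) (last q)" using far q by blast
    also have "\<dots> \<le> length q - 1"
      using tdist_le[OF vwalk_relpow[OF q(1)]] unfolding D_def R_def .
    finally show "enat d \<le> enat (vwalk_length q)" by simp
  qed
  then show "\<exists>P1 P2. XY_path G X Y P1 \<and> XY_path G X Y P2 \<and> set P1 \<inter> set P2 = {} \<and>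
            subgraph_dist G (set P1) (set P2) \<ge> enat d"
    using P disj by blast
qed

end
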